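(* Let $K$ be a field, $S=K[x_1,\ldots,x_n]$, and let $I\subset S$ be a monomial ideal. Then $$\operatorname{slength}(IS[x_{n+1}])=\operatorname{slength}(I),$$ where $IS[x_{n+1}]$ is the extension of $I$ to the polynomial ring $S[x_{n+1}]=K[x_1,\ldots,x_{n+1}]$, its Stanley length being taken over $S[x_{n+1}]$.
   Context: Let $R$ be a polynomial ring over $K$ in $N$ variables and $M$ a finitely generated $\mathbb Z^N$-graded $R$-module. A Stanley decomposition of $M$ is a finite direct sum of $K$-vector spaces $\mathcal D: M=\bigoplus_{i=1}^r m_iK[Z_i]$, where each $m_i\in M$ is homogeneous, $Z_i$ is a subset of the variables of $R$, and $m_iK[Z_i]$ is a free $K[Z_i]$-module. Its length is $\operatorname{slength}(\mathcal D)=r$, and $\operatorname{slength}(M)=\min\{\operatorname{slength}(\mathcal D):\mathcal D\text{ is a Stanley decomposition of }M\}$. The zero module has the empty Stanley decomposition, so $\operatorname{slength}(0)=0$. *)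

theory Defs
  imports "HOL-Algebra.Ideal" "HOL-Algebra.Module"
    "HOL-Library.Poly_Mapping" "HOL-Library.Extended_Nat" "HOL-Library.FuncSet"
begin

(* An exponent vector is a finitely supported map from variable indices to nat, and a
   polynomial a finitely supported map from exponent vectors to coefficients.  All variables
   come from one sequence indexed by nat; the polynomial ring in N variables uses the indices
   0, ..., N - 1.  Hence S is literally a subset of S[x_{n+1}], the new variable being the one
   with index n. *)
type_synonym 'k mpoly = "(nat \<Rightarrow>\<^sub>0 nat) \<Rightarrow>\<^sub>0 'k"

definition polys :: "nat set \<Rightarrow> 'k::field mpoly set" where
  "polys Z = {p. \<forall>t \<in> Poly_Mapping.keys p. Poly_Mapping.keys t \<subseteq> Z}"

definition poly_ring :: "nat \<Rightarrow> 'k::field mpoly ring" where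
  "poly_ring N = \<lparr>carrier = polys {..<N}, mult = (*), one = 1, zero = 0, add = (+)\<rparr>"

definition monomials :: "nat \<Rightarrow> 'k::field mpoly set" where
  "monomials N = {Poly_Mapping.single t 1 | t. Poly_Mapping.keys t \<subseteq> {..<N}}"

definition monomial_ideal :: "nat \<Rightarrow> 'k::field mpoly set \<Rightarrow> bool" where
  "monomial_ideal N I \<longleftrightarrow>
     ideal I (poly_ring N) \<and> (\<exists>A \<subseteq> monomials N. I = Idl\<^bsub>poly_ring N\<^esub> A)"

(* A grading of a module by Z^N is given by its family of homogeneous components G.
   Elements of Z^N are the finitely supported a with support in {..<N}. *)
definition homogeneous :: "nat \<Rightarrow> ((nat \<Rightarrow>\<^sub>0 int) \<Rightarrow> 'm set) \<Rightarrow> 'm \<Rightarrow> bool" where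
  "homogeneous N G m \<longleftrightarrow> (\<exists>a. Poly_Mapping.keys a \<subseteq> {..<N} \<and> m \<in> G a)"

definition stanley_space :: "('k::field mpoly, 'm) module \<Rightarrow> 'm \<Rightarrow> nat set \<Rightarrow> 'm set" where
  "stanley_space M m Z = (\<lambda>p. p \<odot>\<^bsub>M\<^esub> m) ` polys Z"

(* m K[Z] is a free K[Z]-module with basis m; in particular m is nonzero. *)
definition free_generator :: "('k::field mpoly, 'm) module \<Rightarrow> 'm \<Rightarrow> nat set \<Rightarrow> bool" where
  "free_generator M m Z \<longleftrightarrow> (\<forall>p \<in> polys Z. p \<odot>\<^bsub>M\<^esub> m = \<zero>\<^bsub>M\<^esub> \<longrightarrow> p = 0)"

(* M is a module over poly_ring N with homogeneous components G, and D lists the pairs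
   (m_i, Z_i).  The last conjunct says that M is the internal direct sum of the m_i K[Z_i]:
   every element of M is the sum of exactly one family of elements of the summands. *)
definition stanley_decomposition ::
  "nat \<Rightarrow> ('k::field mpoly, 'm) module \<Rightarrow> ((nat \<Rightarrow>\<^sub>0 int) \<Rightarrow> 'm set) \<Rightarrow> ('m \<times> nat set) list \<Rightarrow> bool"
where
  "stanley_decomposition N M G D \<longleftrightarrow>
     (\<forall>(m, Z) \<in> set D.
        m \<in> carrier M \<and> homogeneous N G m \<and> Z \<subseteq> {..<N} \<and> free_generator M m Z) \<and>
     bij_betw (\<lambda>u. finsum M u {..<length D})
       (\<Pi>\<^sub>E i \<in> {..<length D}. stanley_space M (fst (D ! i)) (snd (D ! i)))
       (carrier M)"

(* The infimum in enat of a nonempty set of lengths is its minimum; the value would be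
   \<infinity>, rather than some natural number, if there were no Stanley decomposition. *)
definition slength ::
  "nat \<Rightarrow> ('k::field mpoly, 'm) module \<Rightarrow> ((nat \<Rightarrow>\<^sub>0 int) \<Rightarrow> 'm set) \<Rightarrow> enat" where
  "slength N M G = (INF D \<in> {D. stanley_decomposition N M G D}. enat (length D))"

(* The fields mult and one of the module record play no role for modules. *)
definition ideal_module :: "'k::field mpoly set \<Rightarrow> ('k mpoly, 'k mpoly) module" where
  "ideal_module I =
     \<lparr>carrier = I, mult = (*), one = 1, zero = 0, add = (+), smult = (*)\<rparr>"

definition ideal_component :: "nat \<Rightarrow> 'k::field mpoly set \<Rightarrow> (nat \<Rightarrow>\<^sub>0 int) \<Rightarrow> 'k mpoly set" where
  "ideal_component N I a =
     {p \<in> I. \<forall>t \<in> Poly_Mapping.keys p. \<forall>i < N.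
        int (Poly_Mapping.lookup t i) = Poly_Mapping.lookup a i}"

definition slength_ideal :: "nat \<Rightarrow> 'k::field mpoly set \<Rightarrow> enat" where
  "slength_ideal N I = slength N (ideal_module I) (ideal_component N I)"

lemma polys_closed:
  fixes p q :: "'k::field mpoly"
  shows "0 \<in> polys Z" "1 \<in> polys Z"
    "p \<in> polys Z \<Longrightarrow> - p \<in> polys Z"
    "p \<in> polys Z \<Longrightarrow> q \<in> polys Z \<Longrightarrow> p + q \<in> polys Z"
    "p \<in> polys Z \<Longrightarrow> q \<in> polys Z \<Longrightarrow> p * q \<in> polys Z"
proof -
  show "0 \<in> polys Z" by (simp add: polys_def)
  show "1 \<in> polys Z" by (simp add: polys_def)
  show "- p \<in> polys Z" if "p \<in> polys Z" using that by (simp add: polys_def)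
  show "p + q \<in> polys Z" if "p \<in> polys Z" "q \<in> polys Z"
    using that Poly_Mapping.keys_add[of p q] unfolding polys_def by blast
  show "p * q \<in> polys Z" if pq: "p \<in> polys Z" "q \<in> polys Z"
    unfolding polys_def
  proof (intro CollectI ballI)
    fix t assume "t \<in> Poly_Mapping.keys (p * q)"
    then obtain a b where "a \<in> Poly_Mapping.keys p" "b \<in> Poly_Mapping.keys q" "t = a + b"
      using Poly_Mapping.keys_mult[of p q] by blast
    then show "Poly_Mapping.keys t \<subseteq> Z"
      using pq Poly_Mapping.keys_add[of a b] unfolding polys_def by blast
  qed
qed

lemma cring_poly_ring: "cring (poly_ring N :: 'k::field mpoly ring)"
proof (rule cringI)
  show "abelian_group (poly_ring N :: 'k mpoly ring)"
  proof (rule abelian_groupI)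
    fix x :: "'k mpoly" assume x: "x \<in> carrier (poly_ring N)"
    then show "\<exists>y \<in> carrier (poly_ring N). y \<oplus>\<^bsub>poly_ring N\<^esub> x = \<zero>\<^bsub>poly_ring N\<^esub>"
      by (intro bexI[of _ "- x"]) (simp_all add: poly_ring_def polys_closed)
  qed (simp_all add: poly_ring_def polys_closed algebra_simps)
  show "comm_monoid (poly_ring N :: 'k mpoly ring)"
    by (rule comm_monoidI) (simp_all add: poly_ring_def polys_closed algebra_simps)
qed (simp add: poly_ring_def distrib_right)

lemma module_ideal_module:
  fixes I :: "'k::field mpoly set"
  assumes "ideal I (poly_ring N)"
  shows "Module.module (poly_ring N) (ideal_module I)"
proof -
  interpret ideal I "poly_ring N" by (rule assms)
  have sub: "I \<subseteq> polys {..<N}" using a_subset by (simp add: poly_ring_def)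
  have zero: "0 \<in> I" using additive_subgroup.zero_closed[OF additive_subgroup_axioms] by (simp add: poly_ring_def)
  have add: "x + y \<in> I" if "x \<in> I" "y \<in> I" for x y
    using additive_subgroup.a_closed[OF additive_subgroup_axioms that] by (simp add: poly_ring_def)
  have mult: "r * x \<in> I" if "r \<in> polys {..<N}" "x \<in> I" for r x
    using I_l_closed[OF that(2), of r] that(1) by (simp add: poly_ring_def)
  have neg: "- x \<in> I" if "x \<in> I" for x
    using mult[OF _ that, of "- 1"] by (simp add: polys_closed)
  show ?thesis
  proof (rule Module.moduleI)
    show "abelian_group (ideal_module I)"
    proof (rule abelian_groupI)
      fix x assume "x \<in> carrier (ideal_module I)"
      then show "\<exists>y \<in> carrier (ideal_module I). y \<oplus>\<^bsub>ideal_module I\<^esub> x = \<zero>\<^bsub>ideal_module I\<^esub>"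
        by (intro bexI[of _ "- x"]) (simp_all add: ideal_module_def neg)
    qed (simp_all add: ideal_module_def zero add algebra_simps)
  qed (rule cring_poly_ring, simp_all add: ideal_module_def poly_ring_def mult algebra_simps)
qed

end

theory Submission
  imports Defs
begin

text \<open>
  A monomial ideal has at most one-dimensional homogeneous components, so each generator of a
  Stanley decomposition is a monomial up to a nonzero constant, and the decomposition amounts to a
  partition of the set of exponents of the ideal into cones \<open>t + \<nat>\<^sup>Z\<close>.  A partition for \<open>I\<close>
  becomes one for its extension by adding the new variable to every \<open>Z\<close>.  Conversely, intersecting
  a partition for the extension with the hyperplane where the new exponent vanishes
  keeps the cones whose vertex lies on it (minus the new direction), discards the others, and
  partitions the exponents of \<open>I\<close>.
\<close>

section \<open>Cones of exponents and partitions into cones\<close>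

definition cone :: "(nat \<Rightarrow>\<^sub>0 nat) \<Rightarrow> nat set \<Rightarrow> (nat \<Rightarrow>\<^sub>0 nat) set" where
  "cone t Z = (+) t ` {s. Poly_Mapping.keys s \<subseteq> Z}"

text \<open>The exponents of the monomials in the ideal of \<open>poly_ring N\<close> generated by
  the monomials with exponents in \<open>T\<close>. Fixing \<open>T\<close> and raising
  \<open>N\<close> by one passes from an ideal to its extension.\<close>

definition upset :: "nat \<Rightarrow> (nat \<Rightarrow>\<^sub>0 nat) set \<Rightarrow> (nat \<Rightarrow>\<^sub>0 nat) set" where
  "upset N T = (\<Union>t\<in>T. cone t {..<N})"

definition polys_on :: "(nat \<Rightarrow>\<^sub>0 nat) set \<Rightarrow> 'k::field mpoly set" where
  "polys_on E = {p. Poly_Mapping.keys p \<subseteq> E}"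

text \<open>A list, so that lengths compare directly with those of Stanley decompositions.
  Uniqueness is a count by \<open>filter\<close>, which commutes with the maps applied to the cones
  later.\<close>

definition cone_partition ::
  "nat \<Rightarrow> (nat \<Rightarrow>\<^sub>0 nat) set \<Rightarrow> ((nat \<Rightarrow>\<^sub>0 nat) \<times> nat set) list \<Rightarrow> bool" where
  "cone_partition N E C \<longleftrightarrow>
     (\<forall>(t, Z) \<in> set C. Z \<subseteq> {..<N} \<and> cone t Z \<subseteq> E) \<and>
     (\<forall>e \<in> E. length (filter (\<lambda>(t, Z). e \<in> cone t Z) C) = 1)"

lemma in_cone_iff:
  "e \<in> cone t Z \<longleftrightarrow>
     (\<forall>i. Poly_Mapping.lookup t i \<le> Poly_Mapping.lookup e i \<and>
          (i \<notin> Z \<longrightarrow> Poly_Mapping.lookup e i = Poly_Mapping.lookup t i))"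
  (is "_ = (\<forall>i. ?P i)")
proof
  assume "e \<in> cone t Z"
  then show "\<forall>i. ?P i"
    by (auto simp: cone_def lookup_add in_keys_iff)
next
  assume P: "\<forall>i. ?P i"
  \<comment> \<open>Subtraction of exponents is truncated; it is exact here because \<open>t\<close>
    lies below \<open>e\<close> in every coordinate.\<close>
  then have "e = t + (e - t)"
    by (intro poly_mapping_eqI) (simp add: lookup_add lookup_minus)
  moreover have "Poly_Mapping.keys (e - t) \<subseteq> Z"
    using P by (auto simp: in_keys_iff lookup_minus)
  ultimately show "e \<in> cone t Z"
    unfolding cone_def by blast
qed

lemma self_in_cone [simp]: "t \<in> cone t Z"
  by (simp add: in_cone_iff)

lemma cone_add: "e \<in> cone t Z \<Longrightarrow> Poly_Mapping.keys s \<subseteq> Z \<Longrightarrow> s + e \<in> cone t Z"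
  by (auto simp: in_cone_iff lookup_add in_keys_iff trans_le_add2)

section \<open>Spans of sets of monomials: cones, ideals and direct sums\<close>

lemma poly_expansion:
  "p = (\<Sum>e\<in>Poly_Mapping.keys p. Poly_Mapping.single e (Poly_Mapping.lookup p e))"
proof (rule poly_mapping_eqI)
  fix k
  show "Poly_Mapping.lookup p k = Poly_Mapping.lookup
          (\<Sum>e\<in>Poly_Mapping.keys p. Poly_Mapping.single e (Poly_Mapping.lookup p e)) k"
    by (simp add: lookup_sum lookup_single when_def in_keys_iff)
qed

text \<open>Multiplying by a nonzero term shifts exponents by \<open>t\<close> and rescales
  coefficients by a unit, so a Stanley space generated by a term depends only on the cone.\<close>

lemma image_polys_single:
  fixes c :: "'k::field"
  assumes "c \<noteq> 0"
  shows "(\<lambda>p. p * Poly_Mapping.single t c) ` polys Z = polys_on (cone t Z)"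
proof (intro equalityI subsetI)
  fix q assume "q \<in> (\<lambda>p. p * Poly_Mapping.single t c) ` polys Z"
  then obtain p where p: "p \<in> polys Z" "q = p * Poly_Mapping.single t c" by blast
  have "e \<in> cone t Z" if e: "e \<in> Poly_Mapping.keys q" for e
  proof -
    obtain s where "s \<in> Poly_Mapping.keys p" "e = s + t"
      using e p(2) keys_mult[of p "Poly_Mapping.single t c"] assms by fastforce
    then show ?thesis
      using p(1) by (auto simp: cone_def polys_def add.commute)
  qed
  then show "q \<in> polys_on (cone t Z)"
    by (auto simp: polys_on_def)
next
  fix q :: "'k mpoly" assume q: "q \<in> polys_on (cone t Z)"
  have shift: "e - t + t = e" "Poly_Mapping.keys (e - t) \<subseteq> Z" if e: "e \<in> Poly_Mapping.keys q" for e
  proof -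
    obtain s where "e = t + s" "Poly_Mapping.keys s \<subseteq> Z"
      using e q by (auto simp: polys_on_def cone_def)
    then show "e - t + t = e" "Poly_Mapping.keys (e - t) \<subseteq> Z"
      by (simp_all add: add.commute)
  qed
  \<comment> \<open>The quotient of \<open>q\<close> by the term, formed term by term; the truncated
    \<open>e - t\<close> is exact by \<open>shift\<close>.\<close>
  define p where
    "p = (\<Sum>e\<in>Poly_Mapping.keys q. Poly_Mapping.single (e - t) (Poly_Mapping.lookup q e / c))"
  have "p * Poly_Mapping.single t c =
      (\<Sum>e\<in>Poly_Mapping.keys q. Poly_Mapping.single e (Poly_Mapping.lookup q e))"
    using assms by (simp add: p_def sum_distrib_right mult_single shift)
  then have "q = p * Poly_Mapping.single t c"
    using poly_expansion[of q] by simp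
  moreover have "Poly_Mapping.keys p \<subseteq> (\<Union>e\<in>Poly_Mapping.keys q. {e - t})"
    unfolding p_def by (rule order.trans[OF Poly_Mapping.keys_sum]) auto
  then have "p \<in> polys Z"
    using shift(2) by (fastforce simp: polys_def)
  ultimately show "q \<in> (\<lambda>p. p * Poly_Mapping.single t c) ` polys Z" by blast
qed

lemma keys_upset:
  assumes "\<forall>t\<in>T. Poly_Mapping.keys t \<subseteq> {..<N}"
  shows "\<forall>e\<in>upset N T. Poly_Mapping.keys e \<subseteq> {..<N}"
proof (intro ballI subsetI)
  fix e i assume e: "e \<in> upset N T" and i: "i \<in> Poly_Mapping.keys e"
  obtain t where t: "t \<in> T" "e \<in> cone t {..<N}"
    using e by (auto simp: upset_def)
  show "i \<in> {..<N}"
  proof (rule ccontr)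
    assume "i \<notin> {..<N}"
    then have "i \<in> Poly_Mapping.keys t"
      using t(2) i by (simp add: in_cone_iff in_keys_iff)
    then show False
      using assms t(1) \<open>i \<notin> {..<N}\<close> by blast
  qed
qed

text \<open>Absorption holds because keys of a product are sums of keys, and the up-set is stable
  under adding exponents supported in \<open>{..<N}\<close>.\<close>

lemma ideal_polys_on_upset:
  assumes "\<forall>t\<in>T. Poly_Mapping.keys t \<subseteq> {..<N}"
  shows "ideal (polys_on (upset N T) :: 'k::field mpoly set) (poly_ring N)"
proof -
  let ?E = "upset N T" and ?R = "poly_ring N :: 'k mpoly ring"
  interpret cring ?R by (rule cring_poly_ring)
  have sub: "polys_on ?E \<subseteq> carrier ?R"
    using keys_upset[OF assms] by (auto simp: polys_on_def polys_def poly_ring_def)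
  have mult: "r * p \<in> polys_on ?E" if r: "r \<in> polys {..<N}" and p: "p \<in> polys_on ?E" for r p :: "'k mpoly"
    unfolding polys_on_def
  proof (intro CollectI subsetI)
    fix e assume "e \<in> Poly_Mapping.keys (r * p)"
    then obtain s a where "s \<in> Poly_Mapping.keys r" "a \<in> Poly_Mapping.keys p" "e = s + a"
      using keys_mult[of r p] by blast
    then show "e \<in> ?E"
      using r p cone_add by (fastforce simp: polys_def polys_on_def upset_def)
  qed
  show ?thesis
  proof (rule idealI)
    show "subgroup (polys_on ?E) (add_monoid ?R)"
    proof (rule add.subgroupI)
      show "polys_on ?E \<noteq> {}" by (auto simp: polys_on_def intro: exI[of _ 0])
    next
      fix p :: "'k mpoly" assume p: "p \<in> polys_on ?E"
      \<comment> \<open>The additive inverse of the ring record is identified with negation of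
        polynomials by uniqueness of inverses.\<close>
      have "\<ominus>\<^bsub>?R\<^esub> p = - p"
        using p sub by (intro minus_equality) (auto simp: poly_ring_def polys_closed)
      with p show "\<ominus>\<^bsub>?R\<^esub> p \<in> polys_on ?E" by (simp add: polys_on_def)
    next
      fix p q :: "'k mpoly" assume "p \<in> polys_on ?E" "q \<in> polys_on ?E"
      then show "p \<oplus>\<^bsub>?R\<^esub> q \<in> polys_on ?E"
        using keys_add[of p q] by (auto simp: polys_on_def poly_ring_def)
    qed (use sub in simp)
  next
    show "x \<otimes>\<^bsub>?R\<^esub> p \<in> polys_on ?E" "p \<otimes>\<^bsub>?R\<^esub> x \<in> polys_on ?E"
      if "p \<in> polys_on ?E" "x \<in> carrier ?R" for p x
      using mult[of x p] that by (simp_all add: poly_ring_def mult.commute[of p x])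
  qed (rule ring_axioms)
qed

text \<open>One inclusion is minimality of the generated ideal. For the other, an exponent of the
  up-set splits as \<open>t + s\<close> with \<open>t\<close> in \<open>T\<close>, so each term is a
  multiple of a generator, and a polynomial is the finite sum of its terms.\<close>

lemma genideal_monomials:
  assumes T: "\<forall>t\<in>T. Poly_Mapping.keys t \<subseteq> {..<N}"
  shows "Idl\<^bsub>poly_ring N\<^esub> ((\<lambda>t. Poly_Mapping.single t (1::'k::field)) ` T) = polys_on (upset N T)"
    (is "Idl\<^bsub>?R\<^esub> ?A = _")
proof
  interpret cring ?R by (rule cring_poly_ring)
  have "?A \<subseteq> polys_on (upset N T)"
    by (auto simp: polys_on_def upset_def)
  then show "Idl\<^bsub>?R\<^esub> ?A \<subseteq> polys_on (upset N T)"
    by (intro genideal_minimal ideal_polys_on_upset T)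
  have "?A \<subseteq> carrier ?R"
    by (simp add: image_subset_iff poly_ring_def polys_def T)
  then interpret I: ideal "Idl\<^bsub>?R\<^esub> ?A" ?R
    by (rule genideal_ideal)
  have mono: "Poly_Mapping.single e c \<in> Idl\<^bsub>?R\<^esub> ?A" if "e \<in> upset N T" for e c
  proof -
    obtain t s where ts: "t \<in> T" "Poly_Mapping.keys s \<subseteq> {..<N}" "e = t + s"
      using \<open>e \<in> upset N T\<close> by (auto simp: upset_def cone_def)
    have "Poly_Mapping.single t 1 \<in> Idl\<^bsub>?R\<^esub> ?A"
      using ts(1) by (auto simp: genideal_def)
    moreover have "Poly_Mapping.single s c \<in> carrier ?R"
      using ts(2) by (simp add: poly_ring_def polys_def)
    ultimately have "Poly_Mapping.single s c \<otimes>\<^bsub>?R\<^esub> Poly_Mapping.single t 1 \<in> Idl\<^bsub>?R\<^esub> ?A"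
      by (rule I.I_l_closed)
    then show ?thesis
      by (simp add: ts(3) mult_single add.commute poly_ring_def)
  qed
  have sum: "sum f F \<in> Idl\<^bsub>?R\<^esub> ?A" if "finite F" "\<And>e. e \<in> F \<Longrightarrow> f e \<in> Idl\<^bsub>?R\<^esub> ?A"
    for f and F :: "(nat \<Rightarrow>\<^sub>0 nat) set"
    using that
  proof (induction F)
    case empty
    show ?case using I.zero_closed by (simp add: poly_ring_def)
  next
    case (insert e F)
    then show ?case using I.a_closed[of "f e" "sum f F"] by (simp add: poly_ring_def)
  qed
  show "polys_on (upset N T) \<subseteq> Idl\<^bsub>?R\<^esub> ?A"
  proof
    fix p :: "'k mpoly" assume p: "p \<in> polys_on (upset N T)"
    have "(\<Sum>e\<in>Poly_Mapping.keys p. Poly_Mapping.single e (Poly_Mapping.lookup p e)) \<in> Idl\<^bsub>?R\<^esub> ?A"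
      using p by (intro sum mono) (auto simp: polys_on_def)
    then show "p \<in> Idl\<^bsub>?R\<^esub> ?A"
      using poly_expansion[of p] by simp
  qed
qed

text \<open>Surjectivity puts each exponent of \<open>E\<close> into some \<open>F i\<close>;
  injectivity allows only one, since a monomial lying in two summands would arise from two families.
  Conversely, over a partition the coefficient of a sum at \<open>e\<close> comes from a single
  summand.\<close>

lemma bij_betw_sum_polys_on_iff:
  fixes E :: "(nat \<Rightarrow>\<^sub>0 nat) set" and F :: "nat \<Rightarrow> (nat \<Rightarrow>\<^sub>0 nat) set"
  shows "bij_betw (\<lambda>u. sum u {..<r}) (\<Pi>\<^sub>E i\<in>{..<r}. polys_on (F i))
           (polys_on E :: 'k::field mpoly set) \<longleftrightarrow>
         (\<forall>i<r. F i \<subseteq> E) \<and> (\<forall>e\<in>E. \<exists>!i. i < r \<and> e \<in> F i)"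
    (is "bij_betw ?sum ?U ?P \<longleftrightarrow> ?sub \<and> ?part")
proof
  assume bij: "bij_betw ?sum ?U ?P"
  \<comment> \<open>The family with the monomial of exponent \<open>e\<close> in position
    \<open>i\<close> and zero elsewhere, restricted to \<open>{..<r}\<close> to be a member of the
    extensional product.\<close>
  define unit :: "(nat \<Rightarrow>\<^sub>0 nat) \<Rightarrow> nat \<Rightarrow> nat \<Rightarrow> 'k mpoly" where
    "unit e i = (\<lambda>j\<in>{..<r}. if j = i then Poly_Mapping.single e 1 else 0)" for e i
  have unit: "unit e i \<in> ?U" "?sum (unit e i) = Poly_Mapping.single e 1"
    if "i < r" "e \<in> F i" for e i
    using that by (auto simp: unit_def polys_on_def)
  have ?sub
  proof (intro allI impI subsetI)
    fix i e assume "i < r" "e \<in> F i"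
    then have "Poly_Mapping.single e 1 \<in> ?P"
      using unit bij_betwE[OF bij] by metis
    then show "e \<in> E" by (simp add: polys_on_def)
  qed
  moreover have ?part
  proof (intro ballI ex_ex1I)
    fix e assume "e \<in> E"
    then have "Poly_Mapping.single e 1 \<in> ?P" by (simp add: polys_on_def)
    then obtain u where u: "u \<in> ?U" "Poly_Mapping.single e 1 = ?sum u"
      using bij_betw_imp_surj_on[OF bij] by blast
    have "e \<in> Poly_Mapping.keys (?sum u)"
      by (simp flip: u(2))
    then obtain i where "i < r" "e \<in> Poly_Mapping.keys (u i)"
      using Poly_Mapping.keys_sum[of u "{..<r}"] by blast
    then show "\<exists>i. i < r \<and> e \<in> F i"
      using u(1) by (auto simp: polys_on_def PiE_def Pi_def)
  next
    fix e i j assume "i < r \<and> e \<in> F i" "j < r \<and> e \<in> F j"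
    \<comment> \<open>Both families sum to the same monomial; comparing the equal families at
      position \<open>i\<close> then forces \<open>i = j\<close>.\<close>
    then have "unit e i = unit e j"
      using unit by (intro inj_onD[OF bij_betw_imp_inj_on[OF bij]]) metis+
    then have "unit e i i = unit e j i" by (rule fun_cong)
    moreover have "Poly_Mapping.single e (1 :: 'k) \<noteq> 0"
      by (metis lookup_single_eq lookup_zero zero_neq_one)
    ultimately show "i = j"
      using \<open>i < r \<and> e \<in> F i\<close> by (auto simp: unit_def split: if_splits)
  qed
  ultimately show "?sub \<and> ?part" ..
next
  assume part: "?sub \<and> ?part"
  have lookup_sum_eq: "Poly_Mapping.lookup (?sum u) e = Poly_Mapping.lookup (u i) e"
    if u: "u \<in> ?U" and i: "i < r" "e \<in> F i" for u e i
  proof -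
    have "Poly_Mapping.lookup (u j) e = 0" if "j < r" "j \<noteq> i" for j
    proof -
      have "e \<notin> F j" using part i that by blast
      then have "e \<notin> Poly_Mapping.keys (u j)"
        using u \<open>j < r\<close> by (auto simp: polys_on_def PiE_def Pi_def)
      then show ?thesis by (simp add: in_keys_iff)
    qed
    then have "(\<Sum>j<r. Poly_Mapping.lookup (u j) e) =
        (\<Sum>j<r. if j = i then Poly_Mapping.lookup (u i) e else 0)"
      by (intro sum.cong) auto
    then show ?thesis
      using i(1) by (simp add: lookup_sum)
  qed
  show "bij_betw ?sum ?U ?P"
    unfolding bij_betw_def
  proof (intro conjI inj_onI equalityI subsetI)
    fix u v assume uv: "u \<in> ?U" "v \<in> ?U" "?sum u = ?sum v"
    show "u = v"
    proof (rule PiE_ext[OF uv(1,2)])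
      fix i assume i: "i \<in> {..<r}"
      show "u i = v i"
      proof (rule poly_mapping_eqI)
        fix e
        show "Poly_Mapping.lookup (u i) e = Poly_Mapping.lookup (v i) e"
        proof (cases "e \<in> F i")
          case True
          then show ?thesis
            using lookup_sum_eq[OF uv(1)] lookup_sum_eq[OF uv(2)] uv(3) i by fastforce
        next
          case False
          then have "e \<notin> Poly_Mapping.keys (u i)" "e \<notin> Poly_Mapping.keys (v i)"
            using uv(1,2) i by (auto simp: polys_on_def PiE_def Pi_def)
          then show ?thesis by (simp add: in_keys_iff)
        qed
      qed
    qed
  next
    fix p assume "p \<in> ?sum ` ?U"
    then obtain u where u: "u \<in> ?U" "p = ?sum u" by blast
    have "Poly_Mapping.keys p \<subseteq> (\<Union>i<r. Poly_Mapping.keys (u i))"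
      unfolding u(2) by (rule Poly_Mapping.keys_sum)
    also have "\<dots> \<subseteq> E"
      using u(1) part by (fastforce simp: polys_on_def PiE_def Pi_def)
    finally show "p \<in> ?P" by (simp add: polys_on_def)
  next
    fix p :: "'k mpoly" assume p: "p \<in> ?P"
    \<comment> \<open>Distributes the terms of \<open>p\<close>: component \<open>i\<close> keeps
      those with exponent in \<open>F i\<close>.\<close>
    define u where "u = (\<lambda>i\<in>{..<r}. Poly_Mapping.mapp (\<lambda>e c. if e \<in> F i then c else 0) p)"
    have lookup_u: "Poly_Mapping.lookup (u i) e = (if e \<in> F i then Poly_Mapping.lookup p e else 0)"
      if "i < r" for i e
      using that by (simp add: u_def lookup_mapp when_def in_keys_iff)
    have u: "u \<in> ?U"
    proof (rule PiE_I)
      show "u i \<in> polys_on (F i)" if "i \<in> {..<r}" for i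
        using that by (auto simp: polys_on_def in_keys_iff lookup_u split: if_splits)
    qed (simp add: u_def)
    have "?sum u = p"
    proof (rule poly_mapping_eqI)
      fix e
      show "Poly_Mapping.lookup (?sum u) e = Poly_Mapping.lookup p e"
      proof (cases "e \<in> E")
        case True
        then obtain i where "i < r" "e \<in> F i" using part by blast
        then show ?thesis
          using lookup_sum_eq[OF u] lookup_u by simp
      next
        case False
        then have "Poly_Mapping.lookup p e = 0"
          using p by (auto simp: polys_on_def in_keys_iff)
        then show ?thesis by (simp add: lookup_sum lookup_u cong: if_cong)
      qed
    qed
    then show "p \<in> ?sum ` ?U" using u by blast
  qed
qed

section \<open>Stanley decompositions of a monomial ideal and cone partitions\<close>

lemma ideal_module_simps [simp]:
  "carrier (ideal_module I) = I"
  "add (ideal_module I) = (+)"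
  "zero (ideal_module I) = 0"
  "smult (ideal_module I) = (*)"
  by (simp_all add: ideal_module_def)

lemma finsum_ideal_module_polys_on:
  assumes "finite A" "\<And>i. i \<in> A \<Longrightarrow> u i \<in> polys_on E"
  shows "finsum (ideal_module (polys_on E :: 'k::field mpoly set)) u A = sum u A"
proof -
  have add: "p + q \<in> polys_on E" if "p \<in> polys_on E" "q \<in> polys_on E" for p q :: "'k mpoly"
    using that keys_add[of p q] by (auto simp: polys_on_def)
  have zero: "(0 :: 'k mpoly) \<in> polys_on E" by (simp add: polys_on_def)
  interpret abelian_monoid "ideal_module (polys_on E :: 'k mpoly set)"
    by (rule abelian_monoidI) (simp_all add: add zero algebra_simps)
  show ?thesis
    using assms
  proof (induction A)
    case empty
    show ?case by simp
  next
    case (insert a A)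
    then show ?case
      by (subst finsum_insert) auto
  qed
qed

text \<open>Links uniqueness of an index, as it comes from direct sums, to the count in
  \<open>cone_partition\<close>: the filtered list is as long as the set of matching indices is
  large.\<close>

lemma unique_index_iff_length_filter:
  "(\<exists>!i. i < length xs \<and> P (xs ! i)) \<longleftrightarrow> length (filter P xs) = 1"
  unfolding length_filter_conv_card One_nat_def card_1_singleton_iff set_eq_iff
  by (simp add: Ex1_def)  metis

lemma stanley_space_single:
  "c \<noteq> 0 \<Longrightarrow>
     stanley_space (ideal_module I) (Poly_Mapping.single t (c::'k::field)) Z = polys_on (cone t Z)"
  by (simp add: stanley_space_def image_polys_single)

text \<open>Allowing any nonzero coefficient in \<open>D\<close> lets the one equivalence serve both
  translations: from cones to generators with coefficient 1, and from arbitrary generators back to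
  cones.\<close>

lemma bij_betw_finsum_iff_unique_cone:
  fixes D :: "('k::field mpoly \<times> nat set) list"
  assumes len: "length D = length C"
    and D: "\<And>i. i < length C \<Longrightarrow>
              \<exists>c. c \<noteq> 0 \<and> D ! i = (Poly_Mapping.single (fst (C ! i)) c, snd (C ! i))"
    and sub: "\<And>i. i < length C \<Longrightarrow> cone (fst (C ! i)) (snd (C ! i)) \<subseteq> E"
  shows "bij_betw (\<lambda>u. finsum (ideal_module (polys_on E)) u {..<length D})
           (\<Pi>\<^sub>E i\<in>{..<length D}. stanley_space (ideal_module (polys_on E)) (fst (D ! i)) (snd (D ! i)))
           (polys_on E) \<longleftrightarrow>
         (\<forall>e\<in>E. length (filter (\<lambda>(t, Z). e \<in> cone t Z) C) = 1)"
    (is "bij_betw ?finsum ?U _ \<longleftrightarrow> _")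
proof -
  let ?F = "\<lambda>i. cone (fst (C ! i)) (snd (C ! i))"
  have "stanley_space (ideal_module (polys_on E)) (fst (D ! i)) (snd (D ! i)) = polys_on (?F i)"
    if "i < length C" for i
    using D[OF that] by (auto simp: stanley_space_single)
  then have U: "?U = (\<Pi>\<^sub>E i\<in>{..<length C}. polys_on (?F i))"
    unfolding len by (intro PiE_cong) auto
  have finsum: "?finsum u = sum u {..<length C}" if "u \<in> (\<Pi>\<^sub>E i\<in>{..<length C}. polys_on (?F i))" for u
    unfolding len
  proof (rule finsum_ideal_module_polys_on)
    fix i assume i: "i \<in> {..<length C}"
    then have "u i \<in> polys_on (?F i)" using that by (rule PiE_mem[rotated])
    then show "u i \<in> polys_on E"
      using sub[of i] i by (auto simp: polys_on_def)
  qed simp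
  have "bij_betw ?finsum ?U (polys_on E) \<longleftrightarrow>
      bij_betw (\<lambda>u. sum u {..<length C}) (\<Pi>\<^sub>E i\<in>{..<length C}. polys_on (?F i))
        (polys_on E :: 'k mpoly set)"
    unfolding U by (rule bij_betw_cong) (rule finsum)
  also have "\<dots> \<longleftrightarrow> (\<forall>e\<in>E. \<exists>!i. i < length C \<and> e \<in> ?F i)"
    unfolding bij_betw_sum_polys_on_iff using sub by blast
  also have "\<dots> \<longleftrightarrow> (\<forall>e\<in>E. length (filter (\<lambda>(t, Z). e \<in> cone t Z) C) = 1)"
    unfolding case_prod_beta unique_index_iff_length_filter[of C "\<lambda>x. _ \<in> cone (fst x) (snd x)"] ..
  finally show ?thesis .
qed

text \<open>The multidegree fixes the first \<open>N\<close> entries of every key of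
  \<open>m\<close>, and the support condition makes all others zero, so \<open>m\<close> has just
  one key.\<close>

lemma homogeneous_eq_single:
  fixes m :: "'k::field mpoly"
  assumes supp: "\<forall>e\<in>E. Poly_Mapping.keys e \<subseteq> {..<N}"
    and m: "m \<in> polys_on E" "m \<noteq> 0"
    and hom: "homogeneous N (ideal_component N (polys_on E)) m"
  obtains t c where "t \<in> E" "c \<noteq> 0" "m = Poly_Mapping.single t c"
proof -
  obtain a where a: "\<forall>t\<in>Poly_Mapping.keys m. \<forall>i<N. int (Poly_Mapping.lookup t i) = Poly_Mapping.lookup a i"
    using hom by (auto simp: homogeneous_def ideal_component_def)
  obtain t where t: "t \<in> Poly_Mapping.keys m"
    using m(2) keys_eq_empty by blast
  have "e = t" if e: "e \<in> Poly_Mapping.keys m" for e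
  proof (rule poly_mapping_eqI)
    fix i
    show "Poly_Mapping.lookup e i = Poly_Mapping.lookup t i"
    proof (cases "i < N")
      case True
      then have "int (Poly_Mapping.lookup e i) = int (Poly_Mapping.lookup t i)"
        using a e t by metis
      then show ?thesis by simp
    next
      case False
      then have "i \<notin> Poly_Mapping.keys e" "i \<notin> Poly_Mapping.keys t"
        using supp m(1) e t by (auto simp: polys_on_def)
      then show ?thesis by (simp add: in_keys_iff)
    qed
  qed
  with t have "Poly_Mapping.keys m = {t}" by blast
  then have "m = Poly_Mapping.single t (Poly_Mapping.lookup m t)"
    using poly_expansion[of m] by simp
  then show thesis
    using that[of t "Poly_Mapping.lookup m t"] t m(1) by (auto simp: polys_on_def in_keys_iff)
qed

lemma homogeneous_single:
  assumes "t \<in> E" "Poly_Mapping.keys t \<subseteq> {..<N}"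
  shows "homogeneous N (ideal_component N (polys_on E)) (Poly_Mapping.single t (1::'k::field))"
  unfolding homogeneous_def
proof (intro exI conjI)
  \<comment> \<open>The multidegree is the exponent itself, with its entries read as
    integers.\<close>
  have lookup: "Poly_Mapping.lookup (Poly_Mapping.map int t) i = int (Poly_Mapping.lookup t i)" for i
    by (simp add: Poly_Mapping.map.rep_eq when_def)
  show "Poly_Mapping.keys (Poly_Mapping.map int t) \<subseteq> {..<N}"
    using assms(2) by (auto simp: in_keys_iff lookup subset_iff)
  show "Poly_Mapping.single t (1::'k) \<in> ideal_component N (polys_on E) (Poly_Mapping.map int t)"
    using assms(1) by (simp add: ideal_component_def polys_on_def lookup)
qed

lemma cone_mono: "Y \<subseteq> Z \<Longrightarrow> cone t Y \<subseteq> cone t Z"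
  by (auto simp: cone_def)

lemma cone_trans: "e \<in> cone t Z \<Longrightarrow> t \<in> cone s Y \<Longrightarrow> e \<in> cone s (Z \<union> Y)"
  unfolding in_cone_iff by (metis Un_iff order_trans)

lemma cone_subset_upset: "t \<in> upset N T \<Longrightarrow> Z \<subseteq> {..<N} \<Longrightarrow> cone t Z \<subseteq> upset N T"
  unfolding upset_def using cone_trans[of _ t Z _ "{..<N}"] by (force simp: Un_absorb1)

lemma stanley_decomposition_of_cone_partition:
  assumes supp: "\<forall>e\<in>E. Poly_Mapping.keys e \<subseteq> {..<N}"
    and C: "cone_partition N E C"
  shows "stanley_decomposition N (ideal_module (polys_on E)) (ideal_component N (polys_on E))
           (map (\<lambda>(t, Z). (Poly_Mapping.single t (1::'k::field), Z)) C)"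
    (is "stanley_decomposition N ?M ?G ?D")
  unfolding stanley_decomposition_def ideal_module_simps
proof (intro conjI ballI)
  have mem: "Z \<subseteq> {..<N}" "cone t Z \<subseteq> E" "t \<in> E" if "(t, Z) \<in> set C" for t Z
  proof -
    show "Z \<subseteq> {..<N}" "cone t Z \<subseteq> E"
      using C that by (auto simp: cone_partition_def)
    then show "t \<in> E"
      using self_in_cone by blast
  qed
  fix x assume "x \<in> set ?D"
  then obtain t Z where x: "x = (Poly_Mapping.single t 1, Z)" "(t, Z) \<in> set C" by auto
  have "Poly_Mapping.single t (1::'k) \<noteq> 0"
    by (metis lookup_single_eq lookup_zero zero_neq_one)
  \<comment> \<open>Polynomials over a field have no zero divisors, so every nonzero element
    generates freely.\<close>
  then have "free_generator ?M (Poly_Mapping.single t 1) Z"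
    by (simp add: free_generator_def)
  moreover have "homogeneous N ?G (Poly_Mapping.single t (1::'k))"
    using mem(3)[OF x(2)] supp by (intro homogeneous_single) auto
  ultimately show "case x of (m, Z) \<Rightarrow>
      m \<in> polys_on E \<and> homogeneous N ?G m \<and> Z \<subseteq> {..<N} \<and> free_generator ?M m Z"
    using mem[OF x(2)] by (simp add: x(1)) (simp add: polys_on_def)
next
  have nth: "(fst (C ! i), snd (C ! i)) \<in> set C" if "i < length C" for i
    using that by simp
  show "bij_betw (\<lambda>u. finsum ?M u {..<length ?D})
      (\<Pi>\<^sub>E i\<in>{..<length ?D}. stanley_space ?M (fst (?D ! i)) (snd (?D ! i))) (polys_on E)"
  proof (subst bij_betw_finsum_iff_unique_cone[of _ C])
    show "\<exists>c. c \<noteq> 0 \<and> ?D ! i = (Poly_Mapping.single (fst (C ! i)) c, snd (C ! i))"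
      if "i < length C" for i
      using that by (intro exI[of _ 1]) (simp add: case_prod_beta)
    show "cone (fst (C ! i)) (snd (C ! i)) \<subseteq> E" if "i < length C" for i
      using C nth[OF that] unfolding cone_partition_def by blast
    show "\<forall>e\<in>E. length (filter (\<lambda>(t, Z). e \<in> cone t Z) C) = 1"
      using C by (simp add: cone_partition_def)
  qed simp
qed

text \<open>Each generator is replaced by its exponent, forgetting the constant; the hypothesis
  \<open>up\<close> places the cone in \<open>E\<close> once its vertex is there.\<close>

lemma cone_partition_of_stanley_decomposition:
  fixes D :: "('k::field mpoly \<times> nat set) list"
  assumes supp: "\<forall>e\<in>E. Poly_Mapping.keys e \<subseteq> {..<N}"
    and up: "\<And>t Z. t \<in> E \<Longrightarrow> Z \<subseteq> {..<N} \<Longrightarrow> cone t Z \<subseteq> E"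
    and D: "stanley_decomposition N (ideal_module (polys_on E)) (ideal_component N (polys_on E)) D"
  obtains C where "cone_partition N E C" "length C = length D"
proof -
  let ?M = "ideal_module (polys_on E) :: ('k mpoly, 'k mpoly) module"
  have "\<exists>t. snd x \<subseteq> {..<N} \<and> t \<in> E \<and> (\<exists>c. c \<noteq> 0 \<and> fst x = Poly_Mapping.single t c)"
    if "x \<in> set D" for x
  proof -
    obtain m Z where x: "x = (m, Z)" by fastforce
    have m: "m \<in> polys_on E" "homogeneous N (ideal_component N (polys_on E)) m"
        "Z \<subseteq> {..<N}" "free_generator ?M m Z"
      using D that by (auto simp: stanley_decomposition_def x)
    \<comment> \<open>Freeness tested on the polynomial 1: if \<open>m\<close> were zero, 1 would be
      zero.\<close>
    have "m \<noteq> 0"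
      using m(4) polys_closed(2)[of Z] by (auto simp: free_generator_def)
    then obtain t c where "t \<in> E" "c \<noteq> 0" "m = Poly_Mapping.single t c"
      using homogeneous_eq_single[OF supp m(1) _ m(2)] by blast
    then show ?thesis using m(3) by (auto simp: x)
  qed
  then obtain f where f: "\<And>x. x \<in> set D \<Longrightarrow> snd x \<subseteq> {..<N}" "\<And>x. x \<in> set D \<Longrightarrow> f x \<in> E"
      "\<And>x. x \<in> set D \<Longrightarrow> \<exists>c. c \<noteq> 0 \<and> fst x = Poly_Mapping.single (f x) c"
    by metis
  let ?C = "map (\<lambda>x. (f x, snd x)) D"
  have "bij_betw (\<lambda>u. finsum ?M u {..<length D})
      (\<Pi>\<^sub>E i\<in>{..<length D}. stanley_space ?M (fst (D ! i)) (snd (D ! i))) (polys_on E)"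
    using D by (simp add: stanley_decomposition_def)
  moreover have "\<exists>c. c \<noteq> 0 \<and> D ! i = (Poly_Mapping.single (fst (?C ! i)) c, snd (?C ! i))"
    if "i < length ?C" for i
    using f(3)[of "D ! i"] that by (auto simp: prod_eq_iff)
  moreover have "cone (fst (?C ! i)) (snd (?C ! i)) \<subseteq> E" if "i < length ?C" for i
    using up f that by simp
  ultimately have "\<forall>e\<in>E. length (filter (\<lambda>(t, Z). e \<in> cone t Z) ?C) = 1"
    by (subst (asm) bij_betw_finsum_iff_unique_cone[of _ ?C]) simp_all
  then have "cone_partition N E ?C"
    using f up by (auto simp: cone_partition_def)
  then show thesis using that[of ?C] by simp
qed

text \<open>Both translations preserve length. The right-hand side no longer mentions the field, so
  what remains is combinatorics of exponents.\<close>

lemma slength_ideal_polys_on_upset: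
  assumes T: "\<forall>t\<in>T. Poly_Mapping.keys t \<subseteq> {..<N}"
  shows "slength_ideal N (polys_on (upset N T) :: 'k::field mpoly set) =
           (INF C\<in>{C. cone_partition N (upset N T) C}. enat (length C))"
  unfolding slength_ideal_def slength_def
proof (rule antisym; rule INF_greatest)
  fix C assume "C \<in> {C. cone_partition N (upset N T) C}"
  then show "(INF D\<in>{D. stanley_decomposition N (ideal_module (polys_on (upset N T) :: 'k mpoly set))
      (ideal_component N (polys_on (upset N T))) D}. enat (length D)) \<le> enat (length C)"
    using stanley_decomposition_of_cone_partition[OF keys_upset[OF T]]
    by (intro INF_lower2[of "map (\<lambda>(t, Z). (Poly_Mapping.single t 1, Z)) C"]) simp_all
next
  fix D :: "('k mpoly \<times> nat set) list"
  assume "D \<in> {D. stanley_decomposition N (ideal_module (polys_on (upset N T)))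
      (ideal_component N (polys_on (upset N T))) D}"
  then have D: "stanley_decomposition N (ideal_module (polys_on (upset N T)))
      (ideal_component N (polys_on (upset N T))) D" ..
  obtain C where "cone_partition N (upset N T) C" "length C = length D"
    by (rule cone_partition_of_stanley_decomposition[OF _ _ D])
       (use keys_upset[OF T] cone_subset_upset[of _ N T] in auto)
  then show "(INF C\<in>{C. cone_partition N (upset N T) C}. enat (length C)) \<le> enat (length D)"
    by (intro INF_lower2[of C]) auto
qed

section \<open>Adjoining and removing the last variable\<close>

lemma in_cone_insert_iff:
  assumes "Poly_Mapping.lookup t n = 0" "n \<notin> Z"
  shows "e \<in> cone t (insert n Z) \<longleftrightarrow> Poly_Mapping.update n 0 e \<in> cone t Z"
  unfolding in_cone_iff lookup_update using assms by (intro iff_allI) auto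

text \<open>A vertex lies below every point of its cone, so a cone meeting the hyperplane where
  entry \<open>n\<close> vanishes has its vertex there. Within that hyperplane the direction
  \<open>n\<close> contributes nothing.\<close>

lemma in_cone_diff_iff:
  assumes "Poly_Mapping.lookup e n = 0"
  shows "Poly_Mapping.lookup t n = 0 \<and> e \<in> cone t (Z - {n}) \<longleftrightarrow> e \<in> cone t Z"
proof -
  have "Poly_Mapping.lookup t n = 0" if "e \<in> cone t Z"
    using that assms unfolding in_cone_iff by (metis le_zero_eq)
  then show ?thesis
    using assms unfolding in_cone_iff by (metis Diff_iff singletonD singletonI)
qed

text \<open>The generators do not involve the variable of index \<open>n\<close>, so membership
  ignores the exponent of that variable.\<close>

lemma in_upset_Suc_iff:
  assumes T: "\<forall>t\<in>T. Poly_Mapping.keys t \<subseteq> {..<n}"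
  shows "e \<in> upset (Suc n) T \<longleftrightarrow> Poly_Mapping.update n 0 e \<in> upset n T"
proof -
  have "Poly_Mapping.lookup t n = 0" if "t \<in> T" for t
    using T that by (fastforce simp: in_keys_iff)
  then show ?thesis
    by (auto simp: upset_def lessThan_Suc in_cone_insert_iff)
qed

lemma lookup_eq_0_upset:
  assumes T: "\<forall>t\<in>T. Poly_Mapping.keys t \<subseteq> {..<n}" and "e \<in> upset n T"
  shows "Poly_Mapping.lookup e n = 0"
proof (rule ccontr)
  assume "Poly_Mapping.lookup e n \<noteq> 0"
  then have "n \<in> Poly_Mapping.keys e" by (simp add: in_keys_iff)
  then show False using keys_upset[OF T] assms(2) by blast
qed

lemma update_lookup_eq: "Poly_Mapping.lookup e n = c \<Longrightarrow> Poly_Mapping.update n c e = e"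
  by (rule poly_mapping_eqI) (auto simp: lookup_update)

text \<open>The up-set and all cones become preimages of the old ones under setting entry
  \<open>n\<close> to 0, so the count at \<open>e\<close> is the old count at
  \<open>Poly_Mapping.update n 0 e\<close>.\<close>

lemma cone_partition_extend:
  assumes T: "\<forall>t\<in>T. Poly_Mapping.keys t \<subseteq> {..<n}"
    and C: "cone_partition n (upset n T) C"
  shows "cone_partition (Suc n) (upset (Suc n) T) (map (\<lambda>(t, Z). (t, insert n Z)) C)"
    (is "cone_partition _ _ ?C")
proof -
  have Z: "Z \<subseteq> {..<n}" and sub: "cone t Z \<subseteq> upset n T" if "(t, Z) \<in> set C" for t Z
    using C that by (auto simp: cone_partition_def)
  have cone: "e \<in> cone t (insert n Z) \<longleftrightarrow> Poly_Mapping.update n 0 e \<in> cone t Z"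
    if "(t, Z) \<in> set C" for t Z e
  proof (rule in_cone_insert_iff)
    show "Poly_Mapping.lookup t n = 0"
      \<comment> \<open>The vertex belongs to its own cone, hence to the up-set in \<open>n\<close>
        variables, where entry \<open>n\<close> vanishes.\<close>
      using sub[OF that] self_in_cone[of t Z] by (intro lookup_eq_0_upset[OF T]) blast
    show "n \<notin> Z" using Z[OF that] by auto
  qed
  have "\<forall>(t, Z)\<in>set ?C. Z \<subseteq> {..<Suc n} \<and> cone t Z \<subseteq> upset (Suc n) T"
  proof
    fix x assume "x \<in> set ?C"
    then obtain t Z where x: "x = (t, insert n Z)" and tZ: "(t, Z) \<in> set C" by auto
    have "insert n Z \<subseteq> {..<Suc n}"
      using Z[OF tZ] by (auto simp: lessThan_Suc)
    moreover have "cone t (insert n Z) \<subseteq> upset (Suc n) T"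
      using cone[OF tZ] sub[OF tZ] by (auto simp: in_upset_Suc_iff[OF T])
    ultimately show "case x of (t, Z) \<Rightarrow> Z \<subseteq> {..<Suc n} \<and> cone t Z \<subseteq> upset (Suc n) T"
      by (simp add: x)
  qed
  moreover have "length (filter (\<lambda>(t, Z). e \<in> cone t Z) ?C) = 1" if e: "e \<in> upset (Suc n) T" for e
  proof -
    have "filter ((\<lambda>(t, Z). e \<in> cone t Z) \<circ> (\<lambda>(t, Z). (t, insert n Z))) C =
        filter (\<lambda>(t, Z). Poly_Mapping.update n 0 e \<in> cone t Z) C"
      by (rule filter_cong) (auto simp: cone)
    then show ?thesis
      using C e by (simp add: filter_map cone_partition_def in_upset_Suc_iff[OF T])
  qed
  ultimately show ?thesis
    unfolding cone_partition_def by blast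
qed

lemma cone_partition_restrict:
  assumes T: "\<forall>t\<in>T. Poly_Mapping.keys t \<subseteq> {..<n}"
    and C: "cone_partition (Suc n) (upset (Suc n) T) C"
  shows "cone_partition n (upset n T)
    (map (\<lambda>(t, Z). (t, Z - {n})) (filter (\<lambda>(t, Z). Poly_Mapping.lookup t n = 0) C))"
    (is "cone_partition _ _ ?C")
proof -
  have upset_iff: "e \<in> upset n T \<longleftrightarrow> e \<in> upset (Suc n) T" if "Poly_Mapping.lookup e n = 0" for e
    using that by (simp add: in_upset_Suc_iff[OF T] update_lookup_eq)
  have Z: "Z \<subseteq> {..<Suc n}" and sub: "cone t Z \<subseteq> upset (Suc n) T" if "(t, Z) \<in> set C" for t Z
    using C that by (auto simp: cone_partition_def)
  have "\<forall>(t, Z)\<in>set ?C. Z \<subseteq> {..<n} \<and> cone t Z \<subseteq> upset n T"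
  proof
    fix x assume "x \<in> set ?C"
    then obtain t Z where x: "x = (t, Z - {n})" and tZ: "(t, Z) \<in> set C"
        and t: "Poly_Mapping.lookup t n = 0" by auto
    have "Z - {n} \<subseteq> {..<n}"
      using Z[OF tZ] by (auto simp: lessThan_Suc)
    moreover have "cone t (Z - {n}) \<subseteq> upset n T"
    proof
      fix e assume e: "e \<in> cone t (Z - {n})"
      then have "Poly_Mapping.lookup e n = 0" using t by (simp add: in_cone_iff)
      moreover have "e \<in> cone t Z" using e cone_mono[of "Z - {n}" Z] by blast
      ultimately show "e \<in> upset n T" using sub[OF tZ] upset_iff by blast
    qed
    ultimately show "case x of (t, Z) \<Rightarrow> Z \<subseteq> {..<n} \<and> cone t Z \<subseteq> upset n T"
      by (simp add: x)
  qed
  moreover have "length (filter (\<lambda>(t, Z). e \<in> cone t Z) ?C) = 1" if e: "e \<in> upset n T" for e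
  proof -
    have e0: "Poly_Mapping.lookup e n = 0"
      using lookup_eq_0_upset[OF T e] .
    \<comment> \<open>At a point of the hyperplane, discarding cones with vertex off it and deleting
      direction \<open>n\<close> from the others changes no membership, so the count is the original
      one.\<close>
    have "filter ((\<lambda>(t, Z). e \<in> cone t Z) \<circ> (\<lambda>(t, Z). (t, Z - {n})))
          (filter (\<lambda>(t, Z). Poly_Mapping.lookup t n = 0) C) =
        filter (\<lambda>(t, Z). e \<in> cone t Z) C"
      by (simp add: case_prod_beta' comp_def in_cone_diff_iff[OF e0])
    then show ?thesis
      using C e upset_iff[OF e0] by (simp add: filter_map cone_partition_def)
  qed
  ultimately show ?thesis
    unfolding cone_partition_def by blast
qed

theorem proposition2p5:
  fixes n :: nat and I :: "'k::field mpoly set"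
  assumes "monomial_ideal n I"
  shows "slength_ideal (Suc n) (Idl\<^bsub>poly_ring (Suc n)\<^esub> I) = slength_ideal n I"
proof -
  obtain A where A: "A \<subseteq> monomials n" "I = Idl\<^bsub>poly_ring n\<^esub> A"
    using assms by (auto simp: monomial_ideal_def)
  \<comment> \<open>The exponents of the given monomial generators; this one set describes both
    \<open>I\<close> and its extension.\<close>
  define T where "T = {t. Poly_Mapping.single t (1::'k) \<in> A \<and> Poly_Mapping.keys t \<subseteq> {..<n}}"
  have T: "\<forall>t\<in>T. Poly_Mapping.keys t \<subseteq> {..<n}"
    by (simp add: T_def)
  then have T': "\<forall>t\<in>T. Poly_Mapping.keys t \<subseteq> {..<Suc n}"
    by (fastforce simp: lessThan_Suc)
  have A_eq: "A = (\<lambda>t. Poly_Mapping.single t 1) ` T"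
    using A(1) by (auto simp: T_def monomials_def)
  have I: "I = polys_on (upset n T)"
    unfolding A(2) A_eq by (rule genideal_monomials[OF T])
  interpret ring "poly_ring (Suc n) :: 'k mpoly ring"
    using cring_poly_ring by (rule cring.axioms)
  have "upset n T \<subseteq> upset (Suc n) T"
    using cone_mono[of "{..<n}" "{..<Suc n}"] by (fastforce simp: upset_def)
  then have sub: "I \<subseteq> polys_on (upset (Suc n) T)"
    by (auto simp: I polys_on_def)
  have "A \<subseteq> I"
    by (auto simp: A(2) genideal_def)
  \<comment> \<open>The extension is squeezed: \<open>I\<close> already lies in the larger span, and
    that span is generated by \<open>A\<close>, a subset of \<open>I\<close>.\<close>
  have ext: "Idl\<^bsub>poly_ring (Suc n)\<^esub> I = polys_on (upset (Suc n) T)"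
  proof
    show "Idl\<^bsub>poly_ring (Suc n)\<^esub> I \<subseteq> polys_on (upset (Suc n) T)"
      by (intro genideal_minimal ideal_polys_on_upset T' sub)
    have "Idl\<^bsub>poly_ring (Suc n)\<^esub> A \<subseteq> Idl\<^bsub>poly_ring (Suc n)\<^esub> I"
      using \<open>A \<subseteq> I\<close> by (auto simp: genideal_def)
    then show "polys_on (upset (Suc n) T) \<subseteq> Idl\<^bsub>poly_ring (Suc n)\<^esub> I"
      by (simp add: A_eq genideal_monomials[OF T'])
  qed
  show ?thesis
    \<comment> \<open>\<open>ext\<close> is applied first because its left-hand side contains
      \<open>I\<close> in unexpanded form.\<close>
    unfolding ext unfolding I slength_ideal_polys_on_upset[OF T] slength_ideal_polys_on_upset[OF T']
  \<comment> \<open>Extending a partition keeps its length, and restricting one can only shorten it,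
    so each infimum bounds the other.\<close>
  proof (rule antisym; rule INF_greatest)
    fix C assume "C \<in> {C. cone_partition n (upset n T) C}"
    then show "(INF C\<in>{C. cone_partition (Suc n) (upset (Suc n) T) C}. enat (length C)) \<le> enat (length C)"
      using cone_partition_extend[OF T]
      by (intro INF_lower2[of "map (\<lambda>(t, Z). (t, insert n Z)) C"]) simp_all
  next
    fix C assume "C \<in> {C. cone_partition (Suc n) (upset (Suc n) T) C}"
    then show "(INF C\<in>{C. cone_partition n (upset n T) C}. enat (length C)) \<le> enat (length C)"
      using cone_partition_restrict[OF T]
      by (intro INF_lower2[of "map (\<lambda>(t, Z). (t, Z - {n}))
            (filter (\<lambda>(t, Z). Poly_Mapping.lookup t n = 0) C)"]) simp_all
  qed
qed

end
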